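(* Let $n,k,f\ge1$ be integers, and assume the Erdős Girth Conjecture. Then there exists a simple graph $G$ with $n$ vertices, in which both edges and vertices are colored, such that every $f$-MCFT $(2k-1)$-spanner of $G$ has $\Omega(\min\{f^{2-1/k}n^{1+1/k},n^2\})$ edges.
   Context: Erdős Girth Conjecture: for all integers $n,k\ge1$ there is an $n$-vertex graph of girth at least $2k+2$ with $\Omega(n^{1+1/k})$ edges. Colors are arbitrary, and a color may appear on both edges and vertices. For a set $F$ of colors, $G-F$ deletes every edge $e=\{u,v\}$ such that the color of $e$, of $u$, or of $v$ lies in $F$. A subgraph $H$ (inheriting colors) is an $f$-MCFT $t$-spanner of $G$ if for every set $F$ of at most $f$ colors, $\operatorname{dist}_{H-F}(u,v)\le t\cdot\operatorname{dist}_{G-F}(u,v)$ for all vertices $u,v$. *)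

theory Defs
  imports Complex_Main "HOL-Library.Extended_Nat"
begin

text \<open>
  Finite simple graphs are pairs of a vertex set and a set of two-element edge sets.
\<close>

definition simple_graph :: "'v set \<Rightarrow> 'v set set \<Rightarrow> bool" where
  "simple_graph V E \<longleftrightarrow> finite V \<and> (\<forall>e\<in>E. e \<subseteq> V \<and> card e = 2)"

definition is_walk :: "'v set \<Rightarrow> 'v set set \<Rightarrow> 'v \<Rightarrow> 'v list \<Rightarrow> 'v \<Rightarrow> bool" where
  "is_walk V E u p v \<longleftrightarrow>
     p \<noteq> [] \<and> hd p = u \<and> last p = v \<and> set p \<subseteq> V \<and>
     (\<forall>i. Suc i < length p \<longrightarrow> {p ! i, p ! Suc i} \<in> E)"

text \<open>
  Walks are lists of vertices, so their length is one less than that of the list. The distance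
  is \<open>\<infinity>\<close>, the infimum of the empty set, if there is no walk.
\<close>

definition graph_dist :: "'v set \<Rightarrow> 'v set set \<Rightarrow> 'v \<Rightarrow> 'v \<Rightarrow> enat" where
  "graph_dist V E u v = Inf {enat (length p - 1) | p. is_walk V E u p v}"

definition is_cycle :: "'v set set \<Rightarrow> 'v list \<Rightarrow> bool" where
  "is_cycle E p \<longleftrightarrow>
     3 \<le> length p \<and> distinct p \<and>
     (\<forall>i. Suc i < length p \<longrightarrow> {p ! i, p ! Suc i} \<in> E) \<and> {last p, hd p} \<in> E"

text \<open>The girth of a forest is \<open>\<infinity>\<close>.\<close>

definition girth :: "'v set set \<Rightarrow> enat" where
  "girth E = Inf {enat (length p) | p. is_cycle E p}"

text \<open>
  Vertex colors \<open>cv\<close> and edge colors \<open>ce\<close> share one color type, so a color may appear on both.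
  A failing vertex color deletes the incident edges; the vertices themselves stay.
\<close>

definition delete_colors ::
    "('v \<Rightarrow> 'c) \<Rightarrow> ('v set \<Rightarrow> 'c) \<Rightarrow> 'v set set \<Rightarrow> 'c set \<Rightarrow> 'v set set" where
  "delete_colors cv ce E F = {e \<in> E. ce e \<notin> F \<and> (\<forall>v\<in>e. cv v \<notin> F)}"

definition mcft_spanner ::
    "nat \<Rightarrow> nat \<Rightarrow> 'v set \<Rightarrow> 'v set set \<Rightarrow> ('v \<Rightarrow> 'c) \<Rightarrow> ('v set \<Rightarrow> 'c) \<Rightarrow>
     'v set \<Rightarrow> 'v set set \<Rightarrow> bool" where
  "mcft_spanner f t V E cv ce VH EH \<longleftrightarrow>
     simple_graph VH EH \<and> VH \<subseteq> V \<and> EH \<subseteq> E \<and>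
     (\<forall>F. finite F \<and> card F \<le> f \<longrightarrow>
       (\<forall>u\<in>V. \<forall>v\<in>V.
          graph_dist VH (delete_colors cv ce EH F) u v
            \<le> enat t * graph_dist V (delete_colors cv ce E F) u v))"

text \<open>
  The next two definitions fix the constant hidden in \<open>\<Omega>\<close>. A graph on one vertex has no
  edges, so both bounds are false for \<open>n = 1\<close> with any positive constant; they are
  asserted for \<open>n \<ge> 2\<close>. As the graphs are finite, natural numbers suffice as vertices and as
  colors.
\<close>

definition girth_bound :: "real \<Rightarrow> nat \<Rightarrow> bool" where
  "girth_bound c k \<longleftrightarrow>
     (\<forall>n\<ge>2. \<exists>(V :: nat set) E.
        simple_graph V E \<and> card V = n \<and> girth E \<ge> enat (2 * k + 2) \<and>
        real (card E) \<ge> c * real n powr (1 + 1 / real k))"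

definition mcft_lower_bound :: "real \<Rightarrow> nat \<Rightarrow> bool" where
  "mcft_lower_bound c k \<longleftrightarrow>
     (\<forall>n\<ge>2. \<forall>f\<ge>1. \<exists>(V :: nat set) E (cv :: nat \<Rightarrow> nat) (ce :: nat set \<Rightarrow> nat).
        simple_graph V E \<and> card V = n \<and>
        (\<forall>VH EH. mcft_spanner f (2 * k - 1) V E cv ce VH EH \<longrightarrow>
           real (card EH) \<ge>
             c * min (real f powr (2 - 1 / real k) * real n powr (1 + 1 / real k))
                     ((real n)\<^sup>2)))"

text \<open>
  The constant hidden in \<open>\<Omega>\<close> may be read as depending on \<open>k\<close> or as absolute; neither reading
  of the conjecture-to-lower-bound implication subsumes the other, so both are named here.
\<close>

definition erdos_girth_conjecture :: bool where
  "erdos_girth_conjecture \<longleftrightarrow> (\<forall>k\<ge>1. \<exists>c>0. girth_bound c k)"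

definition erdos_girth_conjecture_absolute :: bool where
  "erdos_girth_conjecture_absolute \<longleftrightarrow> (\<exists>c>0. \<forall>k\<ge>1. girth_bound c k)"

end

theory Submission
  imports Defs
begin

text \<open>
  Let \<open>H\<close> be a graph of girth at least \<open>2 k + 2\<close> on \<open>m \<approx> n / s\<close> vertices, where \<open>s\<close> and \<open>r\<close> are both
  about \<open>f / 2\<close>. Take \<open>s\<close> layers of \<open>m\<close> vertices, the layer being the vertex color. Orient \<open>H\<close> and,
  between any two layers \<open>a < b\<close>, put \<open>r\<close> translated copies of the resulting bipartite relation,
  the number of the copy being the edge color. The translates can be chosen so that together they
  contain at least half of \<open>min (r * card H) (m\<^sup>2)\<close> pairs. Deleting all layers but two and all edge
  colors but one leaves a graph that maps injectively on edges into \<open>H\<close>, so there no edge has a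
  detour of length at most \<open>2 k - 1\<close>: every edge belongs to every spanner. There are
  about \<open>s\<^sup>2 * min (r * m powr (1 + 1 / k)) (m\<^sup>2)\<close> edges, which is the claimed bound. If \<open>f \<ge> n - 2\<close>,
  the complete graph with distinct vertex colors does the same.
\<close>

section \<open>Walks, detours and girth\<close>

lemma is_walk_iff_successively:
  "is_walk V E u p v \<longleftrightarrow>
     p \<noteq> [] \<and> hd p = u \<and> last p = v \<and> set p \<subseteq> V \<and> successively (\<lambda>x y. {x, y} \<in> E) p"
  by (auto simp: is_walk_def successively_conv_nth)

lemma is_walk_mono:
  assumes "is_walk V E u p v" "V \<subseteq> V'" "E \<subseteq> E'"
  shows "is_walk V' E' u p v"
  using assms unfolding is_walk_def by blast

text \<open>Walks may repeat vertices, so \<open>\<phi>\<close> need not be injective. The image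
  lives in \<open>UNIV\<close> because cycles are defined by edges alone.\<close>

lemma is_walk_map:
  assumes "is_walk V E u p v" and "\<And>e. e \<in> E \<Longrightarrow> \<phi> ` e \<in> E'"
  shows "is_walk UNIV E' (\<phi> u) (map \<phi> p) (\<phi> v)"
proof -
  have "successively (\<lambda>x y. {x, y} \<in> E) p"
    using assms(1) by (simp add: is_walk_iff_successively)
  then have "successively (\<lambda>x y. {\<phi> x, \<phi> y} \<in> E') p"
    by (rule successively_mono) (use assms(2) in fastforce)
  then show ?thesis
    using assms(1) by (auto simp: is_walk_iff_successively successively_map hd_map last_map)
qed

text \<open>Between two occurrences of a vertex the walk is closed and can be cut out.\<close>

lemma is_walk_imp_distinct_walk:
  assumes "is_walk V E u p v"
  obtains q where "is_walk V E u q v" "distinct q" "length q \<le> length p"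
  using assms
proof (induction "length p" arbitrary: p thesis rule: less_induct)
  case less
  show ?case
  proof (cases "distinct p")
    case True
    then show ?thesis using less.prems by blast
  next
    case False
    then obtain xs ys zs y where p: "p = xs @ [y] @ ys @ [y] @ zs"
      using not_distinct_decomp by blast
    have walk: "is_walk V E u (xs @ [y] @ zs) v"
      using less.prems(2) unfolding p is_walk_iff_successively
      by (auto simp: successively_append_iff successively_Cons hd_append split: if_splits)
    have shorter: "length (xs @ [y] @ zs) < length p" by (simp add: p)
    show ?thesis
      by (rule less.hyps[OF shorter _ walk]) (use shorter less.prems(1) in force)
  qed
qed

text \<open>A detour around an edge, made distinct, is closed by that edge to a cycle with as many
  edges as the distinct walk has vertices.\<close>

lemma girth_le_walk_around_edge:
  assumes e: "{u, v} \<in> E" and "u \<noteq> v" and p: "is_walk V (E - {{u, v}}) u p v"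
  shows "girth E \<le> enat (length p)"
proof -
  obtain q where q: "is_walk V (E - {{u, v}}) u q v" "distinct q" "length q \<le> length p"
    using is_walk_imp_distinct_walk[OF p] .
  \<comment> \<open>One vertex would force \<open>u = v\<close>, and two vertices would use the
    removed edge.\<close>
  have "3 \<le> length q"
  proof (rule ccontr)
    assume "\<not> 3 \<le> length q"
    then consider "q = []" | x where "q = [x]" | x y where "q = [x, y]"
      by (auto simp: length_Suc_conv numeral_3_eq_3 less_Suc_eq not_le)
    then show False
      using q(1) \<open>u \<noteq> v\<close> by cases (auto simp: is_walk_iff_successively)
  qed
  then have "is_cycle E q"
    using q e by (auto simp: is_cycle_def is_walk_def insert_commute)
  then have "girth E \<le> enat (length q)"
    unfolding girth_def by (intro Inf_lower) auto
  also have "\<dots> \<le> enat (length p)" using q(3) by simp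
  finally show ?thesis .
qed

section \<open>Edges that belong to every spanner\<close>

text \<open>A spanner without the edge must still join its ends by a walk of length at most
  \<open>t\<close> that survives \<open>F\<close>; such a walk is a short detour.\<close>

lemma spanner_edge_forced:
  assumes H: "mcft_spanner f t V E cv ce VH EH"
    and F: "finite F" "card F \<le> f"
    and e: "{u, v} \<in> delete_colors cv ce E F" and uv: "u \<in> V" "v \<in> V"
    and detour: "\<And>p. is_walk V (delete_colors cv ce E F - {{u, v}}) u p v \<Longrightarrow> t < length p - 1"
  shows "{u, v} \<in> EH"
proof (rule ccontr)
  assume not_in: "{u, v} \<notin> EH"
  let ?W = "{enat (length p - 1) | p. is_walk VH (delete_colors cv ce EH F) u p v}"
  have "is_walk V (delete_colors cv ce E F) u [u, v] v"
    using e uv by (auto simp: is_walk_iff_successively)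
  then have "graph_dist V (delete_colors cv ce E F) u v \<le> enat (length [u, v] - 1)"
    unfolding graph_dist_def by (intro Inf_lower) blast
  then have "enat t * graph_dist V (delete_colors cv ce E F) u v \<le> enat t * enat 1"
    by (intro mult_left_mono) auto
  moreover have "Inf ?W \<le> enat t * graph_dist V (delete_colors cv ce E F) u v"
    using H F uv unfolding mcft_spanner_def graph_dist_def[of VH] by blast
  ultimately have le: "Inf ?W \<le> enat t" by simp
  \<comment> \<open>A finite infimum excludes the empty set, and by well-ordering it is attained by
    an actual walk.\<close>
  then have "?W \<noteq> {}" by (intro notI) (simp add: top_enat_def)
  then have "Inf ?W \<in> ?W" by (metis (no_types, lifting) Inf_enat_def LeastI_ex ex_in_conv)
  then obtain p where p: "is_walk VH (delete_colors cv ce EH F) u p v"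
    and len: "enat (length p - 1) \<le> enat t"
    using le by (smt (verit, best) mem_Collect_eq)
  have "is_walk V (delete_colors cv ce E F - {{u, v}}) u p v"
    using H not_in by (intro is_walk_mono[OF p]) (auto simp: mcft_spanner_def delete_colors_def)
  then show False using detour len by fastforce
qed

section \<open>Packing translates of a relation into a square\<close>

text \<open>
  Greedy choice: for a fixed set \<open>U\<close> of pairs, the average of \<open>card (S \<inter> U)\<close> over all translates
  \<open>S\<close> of \<open>D\<close> is \<open>card D * card U / m\<^sup>2\<close>, so some translate has half of its pairs outside \<open>U\<close> as long
  as \<open>U\<close> fills less than half of the square. The Latin square \<open>g\<close> plays the role of addition
  modulo \<open>m\<close>.
\<close>

lemma translate_packing:
  fixes g :: "nat \<Rightarrow> nat \<Rightarrow> 'v"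
  assumes g: "\<And>x. x < m \<Longrightarrow> bij_betw (g x) {..<m} V"
    and g_sym: "\<And>x y. g x y = g y x"
    and D: "D \<subseteq> V \<times> V" and "0 < m"
  shows "\<exists>U idx \<alpha> \<beta>. U \<subseteq> {..<m} \<times> {..<m} \<and>
    (\<forall>i. \<alpha> i < m \<and> \<beta> i < m) \<and>
    (\<forall>x y. (x, y) \<in> U \<longrightarrow> idx (x, y) < r \<and> (g (\<alpha> (idx (x, y))) x, g (\<beta> (idx (x, y))) y) \<in> D) \<and>
    min (r * card D) (m\<^sup>2) \<le> 2 * card U"
proof (induction r)
  case 0
  show ?case using \<open>0 < m\<close> by (intro exI[of _ "{}"]) auto
next
  case (Suc r)
  then obtain U idx \<alpha> \<beta> where U: "U \<subseteq> {..<m} \<times> {..<m}"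
    and \<alpha>\<beta>: "\<forall>i. \<alpha> i < m \<and> \<beta> i < m"
    and idx: "\<forall>x y. (x, y) \<in> U \<longrightarrow>
      idx (x, y) < r \<and> (g (\<alpha> (idx (x, y))) x, g (\<beta> (idx (x, y))) y) \<in> D"
    and card_U: "min (r * card D) (m\<^sup>2) \<le> 2 * card U"
    by blast
  let ?Q = "{..<m} \<times> {..<m}"
  define S where "S c d = {z \<in> ?Q. (g c (fst z), g d (snd z)) \<in> D}" for c d
  have fin_U: "finite U" using U finite_subset by blast
  have card_S: "card (S c d) = card D" if "c < m" "d < m" for c d
  proof -
    let ?h = "map_prod (g c) (g d)"
    have bij: "bij_betw ?h ?Q (V \<times> V)"
      using g that by (intro bij_betw_map_prod) auto
    have S: "S c d = ?Q \<inter> ?h -` D" by (auto simp: S_def)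
    have "h ` (A \<inter> h -` D) = D" if "D \<subseteq> h ` A" for h :: "nat \<times> nat \<Rightarrow> 'v \<times> 'v" and A
      using that by blast
    then have "?h ` S c d = D"
      using D bij_betw_imp_surj_on[OF bij] unfolding S by simp
    moreover have "inj_on ?h (S c d)"
      using bij_betw_imp_inj_on[OF bij] by (rule inj_on_subset) (auto simp: S)
    ultimately show ?thesis using card_image by metis
  qed
  \<comment> \<open>Symmetry of \<open>g\<close> exchanges shifts and pairs: the shifts whose
    translate covers a given pair form a translate themselves, so there are \<open>card D\<close> of
    them.\<close>
  have S_sym: "(x, y) \<in> S c d \<longleftrightarrow> (c, d) \<in> S x y" if "(c, d) \<in> ?Q" "(x, y) \<in> ?Q" for c d x y
    using that by (auto simp: S_def g_sym)
  have "\<exists>c d. c < m \<and> d < m \<and> m\<^sup>2 * card (S c d \<inter> U) \<le> card D * card U"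
  proof (rule ccontr)
    assume "\<not> ?thesis"
    then have less: "card D * card U < m\<^sup>2 * card (S c d \<inter> U)" if "(c, d) \<in> ?Q" for c d
      using that by (auto simp: not_le)
    have "(\<Sum>(c, d)\<in>?Q. card (S c d \<inter> U)) = (\<Sum>(c, d)\<in>?Q. card {z \<in> U. z \<in> S c d})"
      by (intro sum.cong) (auto simp: Int_def conj_commute)
    also have "\<dots> = (\<Sum>w\<in>?Q. card {z \<in> U. z \<in> S (fst w) (snd w)})"
      by (simp add: case_prod_beta)
    also have "\<dots> = (\<Sum>w\<in>?Q. \<Sum>z\<in>U. if z \<in> S (fst w) (snd w) then 1 else 0)"
      using fin_U by (simp add: sum.If_cases Int_def)
    also have "\<dots> = (\<Sum>z\<in>U. \<Sum>w\<in>?Q. if z \<in> S (fst w) (snd w) then 1 else 0)"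
      by (rule sum.swap)
    also have "\<dots> = (\<Sum>z\<in>U. card D)"
    proof (rule sum.cong[OF refl])
      fix z assume "z \<in> U"
      then have z: "z \<in> ?Q" using U by blast
      have "(\<Sum>w\<in>?Q. if z \<in> S (fst w) (snd w) then 1 else 0) = card {w \<in> ?Q. z \<in> S (fst w) (snd w)}"
        by (simp add: sum.If_cases Int_def)
      also have "{w \<in> ?Q. z \<in> S (fst w) (snd w)} = S (fst z) (snd z)"
        using z S_sym by (auto simp: S_def g_sym)
      finally show "(\<Sum>w\<in>?Q. if z \<in> S (fst w) (snd w) then 1 else 0) = card D"
        using card_S z by auto
    qed
    also have "\<dots> = card D * card U" by simp
    finally have total: "(\<Sum>(c, d)\<in>?Q. card (S c d \<inter> U)) = card D * card U" .
    have "(\<Sum>w\<in>?Q. card D * card U) < (\<Sum>(c, d)\<in>?Q. m\<^sup>2 * card (S c d \<inter> U))"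
      using less \<open>0 < m\<close> by (intro sum_strict_mono) auto
    also have "\<dots> = m\<^sup>2 * (\<Sum>(c, d)\<in>?Q. card (S c d \<inter> U))"
      by (simp add: sum_distrib_left case_prod_beta)
    finally show False using total by (simp add: power2_eq_square)
  qed
  then obtain c d where cd: "c < m" "d < m" "m\<^sup>2 * card (S c d \<inter> U) \<le> card D * card U"
    by blast
  have fin_S: "finite (S c d)" by (simp add: S_def)
  have "card (U \<union> S c d) + card (S c d \<inter> U) = card U + card D"
    using card_Un_Int[OF fin_U fin_S] card_S[OF cd(1,2)] by (simp add: Int_commute)
  moreover have "2 * card (S c d \<inter> U) \<le> card D" if "2 * card U < m\<^sup>2"
  proof -
    have "m\<^sup>2 * (2 * card (S c d \<inter> U)) \<le> card D * (2 * card U)" using cd(3) by simp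
    also have "\<dots> \<le> m\<^sup>2 * card D" using that by (simp add: mult.commute)
    finally show ?thesis using \<open>0 < m\<close> by simp
  qed
  moreover have "card U \<le> card (U \<union> S c d)" using fin_U fin_S by (intro card_mono) auto
  \<comment> \<open>Either \<open>U\<close> already fills half of the square, or at least half of
    the new translate lies outside \<open>U\<close>.\<close>
  ultimately have card': "min (Suc r * card D) (m\<^sup>2) \<le> 2 * card (U \<union> S c d)"
    using card_U by (cases "2 * card U < m\<^sup>2") (auto simp: min_def split: if_splits)
  \<comment> \<open>Old pairs keep their index below \<open>r\<close>, where the updated shifts
    agree with the old ones; only new pairs get index \<open>r\<close>.\<close>
  show ?case
  proof (intro exI conjI)
    show "U \<union> S c d \<subseteq> ?Q" using U by (auto simp: S_def)
    show "\<forall>i. (\<alpha>(r := c)) i < m \<and> (\<beta>(r := d)) i < m" using \<alpha>\<beta> cd by auto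
    show "\<forall>x y. (x, y) \<in> U \<union> S c d \<longrightarrow>
       (\<lambda>z. if z \<in> U then idx z else r) (x, y) < Suc r \<and>
       (g ((\<alpha>(r := c)) ((\<lambda>z. if z \<in> U then idx z else r) (x, y))) x,
        g ((\<beta>(r := d)) ((\<lambda>z. if z \<in> U then idx z else r) (x, y))) y) \<in> D"
      using idx by (auto simp: S_def less_Suc_eq)
    show "min (Suc r * card D) (m\<^sup>2) \<le> 2 * card (U \<union> S c d)" by (rule card')
  qed
qed

section \<open>The layered graph built from a graph of large girth\<close>

lemma bij_betw_add_mod:
  assumes "x < m"
  shows "bij_betw (\<lambda>c. (x + c) mod m) {..<m} {..<m::nat}"
proof -
  have "inj_on (\<lambda>c. (x + c) mod m) {..<m}"
  proof (rule inj_onI)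
    fix c d assume *: "c \<in> {..<m}" "d \<in> {..<m}" "(x + c) mod m = (x + d) mod m"
    then have "(m - x + (x + c)) mod m = (m - x + (x + d)) mod m"
      by (metis mod_add_right_eq)
    then show "c = d" using * assms by simp
  qed
  moreover have "(\<lambda>c. (x + c) mod m) ` {..<m} \<subseteq> {..<m}" using assms by auto
  ultimately show ?thesis
    by (simp add: bij_betw_def endo_inj_surj)
qed

lemma card_oriented_edges:
  fixes E :: "'v::linorder set set"
  assumes "simple_graph V E"
  shows "card {(v, w). v < w \<and> {v, w} \<in> E} = card E"
proof (rule bij_betw_same_card[of "\<lambda>(v, w). {v, w}"])
  have "\<exists>v w. v < w \<and> {v, w} \<in> E \<and> e = {v, w}" if "e \<in> E" for e
  proof -
    have "card e = 2" using assms that by (simp add: simple_graph_def)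
    then obtain v w where vw: "e = {v, w}" "v \<noteq> w" by (auto simp: card_2_iff)
    show ?thesis
    proof (cases "v < w")
      case True
      then show ?thesis using vw that by blast
    next
      case False
      then show ?thesis using vw that by (intro exI[of _ w] exI[of _ v]) (auto simp: insert_commute)
    qed
  qed
  then show "bij_betw (\<lambda>(v, w). {v, w}) {(v, w). v < w \<and> {v, w} \<in> E} E"
    by (fastforce simp: bij_betw_def inj_on_def doubleton_eq_iff image_iff)
qed

text \<open>There are \<open>s * (s - 1) / 2\<close> pairs of layers, and \<open>s - 1\<close> is at
  least \<open>s / 2\<close>.\<close>

lemma card_pairs_below: "s \<ge> 2 \<Longrightarrow> s\<^sup>2 \<le> 4 * card (SIGMA b:{..<s}. {..<b::nat})"
proof -
  assume "s \<ge> 2"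
  have "2 * (\<Sum>b<s. b) + s = s\<^sup>2"
    by (induction s) (auto simp: power2_eq_square)
  moreover have "2 * s \<le> s\<^sup>2" using \<open>s \<ge> 2\<close> by (simp add: power2_eq_square)
  ultimately show ?thesis by (simp add: card_SigmaI)
qed

text \<open>Isolating one copy between two layers costs \<open>s - 2\<close> layer colors and
  \<open>r - 1\<close> edge colors, whence the budget \<open>s + r \<le> f + 3\<close>. The factor 8
  combines 4 from counting layer pairs with 2 from the packing.\<close>

lemma layered_graph_exists:
  assumes B: "simple_graph (VB :: nat set) EB" "card VB = m" "girth EB \<ge> enat (2 * k + 2)"
    and m: "0 < m" "m * s \<le> n" and s: "s \<ge> 2" "s + r \<le> f + 3"
  shows "\<exists>E (cv :: nat \<Rightarrow> nat) (ce :: nat set \<Rightarrow> nat).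
     simple_graph {..<n} E \<and> s\<^sup>2 * min (r * card EB) (m\<^sup>2) \<le> 8 * card E \<and>
     (\<forall>VH EH. mcft_spanner f (2 * k - 1) {..<n} E cv ce VH EH \<longrightarrow> E \<subseteq> EH)"
proof -
  define D where "D = {(v, w). v < w \<and> {v, w} \<in> EB}"
  have "finite VB" using B(1) by (simp add: simple_graph_def)
  then obtain h where h: "bij_betw h {..<m} VB"
    using B(2) ex_bij_betw_nat_finite[of VB] by (auto simp: atLeast0LessThan)
  define g where "g x c = h ((x + c) mod m)" for x c
  have g: "bij_betw (g x) {..<m} VB" if "x < m" for x
    using bij_betw_trans[OF bij_betw_add_mod[OF that] h] by (simp add: g_def[abs_def] comp_def)
  have g_sym: "g x y = g y x" for x y by (simp add: g_def add.commute)
  have D_sub: "D \<subseteq> VB \<times> VB"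
    using B(1) by (fastforce simp: D_def simple_graph_def)
  obtain U idx \<alpha> \<beta> where U: "U \<subseteq> {..<m} \<times> {..<m}"
    and \<alpha>\<beta>_all: "\<forall>i. \<alpha> i < m \<and> \<beta> i < m"
    and idx_all: "\<forall>x y. (x, y) \<in> U \<longrightarrow>
      idx (x, y) < r \<and> (g (\<alpha> (idx (x, y))) x, g (\<beta> (idx (x, y))) y) \<in> D"
    and card_U: "min (r * card D) (m\<^sup>2) \<le> 2 * card U"
    using translate_packing[of m g VB D r, OF g g_sym D_sub m(1)] by blast
  have \<alpha>\<beta>: "\<alpha> i < m" "\<beta> i < m" for i using \<alpha>\<beta>_all by auto
  have idx: "idx (x, y) < r" "(g (\<alpha> (idx (x, y))) x, g (\<beta> (idx (x, y))) y) \<in> D"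
    if "(x, y) \<in> U" for x y using idx_all that by auto
  \<comment> \<open>Vertex \<open>p < m * s\<close> is the pair of its layer \<open>p div m\<close> and its position \<open>p mod m\<close>; the vertices from \<open>m * s\<close> on are isolated padding.\<close>
  define P where "P = {(p, q). p div m < q div m \<and> q < m * s \<and> (p mod m, q mod m) \<in> U}"
  define E where "E = (\<lambda>(p, q). {p, q}) ` P"
  \<comment> \<open>The offset \<open>s\<close> keeps edge colors apart from the layer colors below
    \<open>s\<close>. \<open>Min\<close> and \<open>Max\<close> recover the ordered pair, since
    pairs in \<open>P\<close> are increasing.\<close>
  define ce where "ce e = s + idx (Min e mod m, Max e mod m)" for e
  define cv where "cv p = p div m" for p
  have P_less: "p < q" if "(p, q) \<in> P" for p q
    using that div_le_mono[of q p m] unfolding P_def by (auto simp: not_less[symmetric])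
  have P_layer: "p div m < q div m" "q div m < s" if "(p, q) \<in> P" for p q
    using that m(1) by (auto simp: P_def less_mult_imp_div_less mult.commute)
  have ce: "ce {p, q} = s + idx (p mod m, q mod m)" if "(p, q) \<in> P" for p q
    using P_less[OF that] by (simp add: ce_def min_def max_def)
  have P_n: "p < n" "q < n" if "(p, q) \<in> P" for p q
    using P_less[OF that] that m(2) by (auto simp: P_def)
  have fin_P: "finite P"
    by (rule finite_subset[of _ "{..<n} \<times> {..<n}"]) (use P_n in auto)
  have "p = p' \<and> q = q'" if "(p, q) \<in> P" "(p', q') \<in> P" "{p, q} = {p', q'}" for p q p' q'
    using that(3) P_less[OF that(1)] P_less[OF that(2)] by (auto simp: doubleton_eq_iff)
  then have "inj_on (\<lambda>(p, q). {p, q}) P" by (force intro!: inj_onI)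
  then have "card E = card P"
    unfolding E_def by (rule card_image)
  moreover have "card ((SIGMA b:{..<s}. {..<b}) \<times> U) \<le> card P"
  proof (rule card_inj_on_le[OF _ _ fin_P])
    let ?\<psi> = "\<lambda>((b, a), (x, y)). (a * m + x, b * m + y)"
    have dm: "(a * m + x) div m = a" "(a * m + x) mod m = x" if "x < m" for a x
      using that by auto
    show "inj_on ?\<psi> ((SIGMA b:{..<s}. {..<b}) \<times> U)"
    proof (rule inj_onI, clarsimp)
      fix b a x y b' a' x' y'
      assume *: "(x, y) \<in> U" "(x', y') \<in> U" "a * m + x = a' * m + x'" "b * m + y = b' * m + y'"
      then have "x < m" "y < m" "x' < m" "y' < m" using U by auto
      then show "b = b' \<and> a = a' \<and> x = x' \<and> y = y'"
        using dm *(3,4) by metis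
    qed
    show "?\<psi> ` ((SIGMA b:{..<s}. {..<b}) \<times> U) \<subseteq> P"
    proof clarsimp
      fix b a x y assume *: "b < s" "a < b" "(x, y) \<in> U"
      then have xy: "x < m" "y < m" using U by auto
      have "b * m + y < (b + 1) * m" using xy by simp
      also have "\<dots> \<le> s * m" using * by (intro mult_le_mono) auto
      finally show "(a * m + x, b * m + y) \<in> P"
        unfolding P_def using * dm xy by (simp add: mult.commute)
    qed
  qed
  ultimately have "card (SIGMA b:{..<s}. {..<b}) * card U \<le> card E"
    by (simp add: card_cartesian_product)
  then have "(4 * card (SIGMA b:{..<s}. {..<b})) * (2 * card U) \<le> 8 * card E" by simp
  moreover have "s\<^sup>2 * min (r * card EB) (m\<^sup>2) \<le> (4 * card (SIGMA b:{..<s}. {..<b})) * (2 * card U)"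
    using card_U card_oriented_edges[OF B(1)] card_pairs_below[OF s(1)]
    by (intro mult_le_mono) (simp_all add: D_def)
  ultimately have card_E: "s\<^sup>2 * min (r * card EB) (m\<^sup>2) \<le> 8 * card E" by linarith
  have simple: "simple_graph {..<n} E"
    unfolding simple_graph_def E_def using P_n by (auto dest: P_less)
  have forced: "e \<in> EH" if H: "mcft_spanner f (2 * k - 1) {..<n} E cv ce VH EH" and "e \<in> E" for VH EH e
  proof -
    obtain p q where e: "e = {p, q}" and pq: "(p, q) \<in> P" using \<open>e \<in> E\<close> by (auto simp: E_def)
    define a b i where "a = p div m" and "b = q div m" and "i = idx (p mod m, q mod m)"
    have ab: "a < b" "b < s" using P_layer[OF pq] by (auto simp: a_def b_def)
    have i: "i < r" using pq idx by (auto simp: i_def P_def)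
    define F where "F = ({..<s} - {a, b}) \<union> ({s..<s + r} - {s + i})"
    have "card F \<le> card ({..<s} - {a, b}) + card ({s..<s + r} - {s + i})"
      unfolding F_def by (rule card_Un_le)
    also have "\<dots> = (s - 2) + (r - 1)" using ab i by (simp add: card_Diff_subset)
    also have "\<dots> \<le> f" using s i by linarith
    finally have card_F: "card F \<le> f" .
    \<comment> \<open>Edges surviving \<open>F\<close> run from layer \<open>a\<close> to layer
      \<open>b\<close>, so the values of \<open>\<phi>\<close> on other layers are
      arbitrary.\<close>
    define \<phi> where "\<phi> x = (if x div m = a then g (\<alpha> i) (x mod m) else g (\<beta> i) (x mod m))" for x
    have survivor: "x div m = a \<and> y div m = b \<and> idx (x mod m, y mod m) = i"
      if "{x, y} \<in> delete_colors cv ce E F" and xy: "(x, y) \<in> P" for x y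
    proof -
      have "x div m \<notin> F" "y div m \<notin> F" "s + idx (x mod m, y mod m) \<notin> F"
        using that ce[OF xy] by (auto simp: delete_colors_def cv_def)
      moreover have "idx (x mod m, y mod m) < r" using xy idx by (auto simp: P_def)
      ultimately show ?thesis using P_layer[OF xy] ab(1) by (auto simp: F_def)
    qed
    have \<phi>: "(\<phi> x, \<phi> y) \<in> D" if "{x, y} \<in> delete_colors cv ce E F" "(x, y) \<in> P" for x y
      using survivor[OF that] idx(2) that(2) ab by (auto simp: \<phi>_def P_def)
    have e_del: "{p, q} \<in> delete_colors cv ce E F"
      using \<open>e \<in> E\<close> ab ce[OF pq] unfolding e delete_colors_def F_def cv_def a_def[symmetric] b_def[symmetric]
      by (auto simp: i_def a_def b_def)
    \<comment> \<open>\<open>\<phi>\<close> may identify vertices of different layers, but not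
      edges: the orientation in \<open>D\<close> excludes a swap of the ends, and within each layer
      \<open>\<phi>\<close> is injective.\<close>
    have proj: "\<phi> ` e' \<in> EB - {{\<phi> p, \<phi> q}}" if e': "e' \<in> delete_colors cv ce E F - {{p, q}}" for e'
    proof -
      obtain x y where e'_eq: "e' = {x, y}" and xy: "(x, y) \<in> P"
        using e' by (auto simp: delete_colors_def E_def)
      have del: "{x, y} \<in> delete_colors cv ce E F" using e' e'_eq by simp
      have D2: "(\<phi> x, \<phi> y) \<in> D" "(\<phi> p, \<phi> q) \<in> D" using \<phi> del xy e_del pq by auto
      have "{\<phi> x, \<phi> y} \<noteq> {\<phi> p, \<phi> q}"
      proof
        assume "{\<phi> x, \<phi> y} = {\<phi> p, \<phi> q}"
        then have eq: "\<phi> x = \<phi> p" "\<phi> y = \<phi> q"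
          using D2 by (auto simp: D_def doubleton_eq_iff)
        have "x div m = p div m" "y div m = q div m"
          using survivor[OF del xy] by (auto simp: a_def b_def)
        moreover have "x mod m = p mod m"
          using eq(1) survivor[OF del xy] survivor[OF e_del pq] m(1)
            bij_betw_imp_inj_on[OF g[OF \<alpha>\<beta>(1)]] by (auto simp: \<phi>_def inj_on_def)
        moreover have "y mod m = q mod m"
          using eq(2) survivor[OF del xy] survivor[OF e_del pq] m(1) ab
            bij_betw_imp_inj_on[OF g[OF \<alpha>\<beta>(2)]] by (auto simp: \<phi>_def inj_on_def)
        ultimately have "x = p" "y = q" by (metis div_mult_mod_eq)+
        then show False using e' e'_eq by simp
      qed
      then show ?thesis using D2 by (auto simp: D_def e'_eq)
    qed
    have "{p, q} \<in> EH"
    proof (rule spanner_edge_forced[OF H _ card_F e_del])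
      show "finite F" by (simp add: F_def)
      show "p \<in> {..<n}" "q \<in> {..<n}" using simple \<open>e \<in> E\<close> by (auto simp: simple_graph_def e)
      fix w assume w: "is_walk {..<n} (delete_colors cv ce E F - {{p, q}}) p w q"
      have "is_walk UNIV (EB - {{\<phi> p, \<phi> q}}) (\<phi> p) (map \<phi> w) (\<phi> q)"
        using w proj by (rule is_walk_map)
      then have "girth EB \<le> enat (length (map \<phi> w))"
        using \<phi>[OF e_del pq] by (intro girth_le_walk_around_edge[of "\<phi> p" "\<phi> q"]) (auto simp: D_def)
      then have "enat (2 * k + 2) \<le> enat (length w)" using B(3) order_trans by fastforce
      then show "2 * k - 1 < length w - 1" by simp
    qed
    then show ?thesis by (simp add: e)
  qed
  show ?thesis using simple card_E forced by (meson subsetI)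
qed

section \<open>The complete graph for large \<open>f\<close>\<close>

text \<open>Deleting the \<open>n - 2\<close> colors of all other vertices isolates one edge. The
  common edge color \<open>n\<close> is no vertex color, so it survives.\<close>

lemma complete_graph_forced:
  assumes f: "n - 2 \<le> f"
    and H: "mcft_spanner f t {..<n} {e. e \<subseteq> {..<n} \<and> card e = 2} id (\<lambda>_. n) VH EH"
  shows "{e. e \<subseteq> {..<n} \<and> card e = 2} \<subseteq> EH"
proof
  fix e assume "e \<in> {e. e \<subseteq> {..<n} \<and> card e = 2}"
  then obtain u v where e: "e = {u, v}" and uv: "u \<noteq> v" "u < n" "v < n"
    by (auto simp: card_2_iff)
  let ?F = "{..<n} - {u, v}"
  let ?G = "delete_colors id (\<lambda>_. n) {e. e \<subseteq> {..<n} \<and> card e = 2} ?F"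
  have only: "?G = {{u, v}}"
    using uv by (auto simp: delete_colors_def card_2_iff)
  have "{u, v} \<in> EH"
  proof (rule spanner_edge_forced[OF H, of ?F])
    show "card ?F \<le> f" using f uv by (simp add: card_Diff_subset)
    fix w assume "is_walk {..<n} (?G - {{u, v}}) u w v"
    then show "t < length w - 1"
      unfolding only using uv by (cases w rule: remdups_adj.cases) (auto simp: is_walk_iff_successively)
  qed (use uv only in auto)
  then show "e \<in> EH" by (simp add: e)
qed

section \<open>Choice of parameters and the constant\<close>

text \<open>The resulting constant depends on \<open>c\<close> but not on \<open>k\<close>, so it
  serves both readings of the hidden constant. The minimum with 1 covers the cases where
  \<open>n\<^sup>2\<close> is the relevant bound.\<close>

lemma mcft_lower_bound_of_girth_bound:
  assumes c: "c > 0" and k: "k \<ge> 1" and gb: "girth_bound c k"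
  shows "mcft_lower_bound (min c 1 / 64) k"
  unfolding mcft_lower_bound_def
proof (intro allI impI)
  fix n f :: nat assume n: "n \<ge> 2" and f: "f \<ge> 1"
  define B where
    "B = min (real f powr (2 - 1 / real k) * real n powr (1 + 1 / real k)) ((real n)\<^sup>2)"
  have "\<exists>E (cv :: nat \<Rightarrow> nat) (ce :: nat set \<Rightarrow> nat). simple_graph {..<n} E \<and> min c 1 / 64 * B \<le> real (card E) \<and>
     (\<forall>VH EH. mcft_spanner f (2 * k - 1) {..<n} E cv ce VH EH \<longrightarrow> E \<subseteq> EH)"
  proof (cases "n - 2 \<le> f")
    case True
    let ?K = "{e. e \<subseteq> {..<n} \<and> card e = 2}"
    have "card ?K = n * (n - 1) div 2"
      by (simp add: n_subsets choose_two)
    moreover have "even (n * (n - 1))" using n by auto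
    ultimately have "2 * card ?K = n * (n - 1)" by simp
    moreover have "n * n \<le> 2 * (n * (n - 1))" using n by (cases n) auto
    ultimately have "n\<^sup>2 \<le> 4 * card ?K" unfolding power2_eq_square by linarith
    then have "real (n\<^sup>2) \<le> real (4 * card ?K)" by (rule of_nat_mono)
    then have K: "(real n)\<^sup>2 \<le> 4 * real (card ?K)" by simp
    have "min c 1 / 64 * B \<le> 1 / 64 * (real n)\<^sup>2"
      using c by (intro mult_mono) (auto simp: B_def)
    then have "min c 1 / 64 * B \<le> real (card ?K)" using K by simp
    moreover have "simple_graph {..<n} ?K" by (auto simp: simple_graph_def)
    ultimately show ?thesis using complete_graph_forced[OF True] by blast
  next
    case False
    \<comment> \<open>The budget \<open>f + 3\<close> is split almost evenly between layers and
      copies. As \<open>f + 3 \<le> n\<close> here, \<open>2 * s \<le> n\<close>, which gives the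
      \<open>m \<ge> 2\<close> that \<open>girth_bound\<close> requires.\<close>
    define s where "s = (f + 1) div 2 + 1"
    define r where "r = f + 3 - s"
    define m where "m = n div s"
    have s: "s \<ge> 2" "s + r = f + 3" "f \<le> 2 * s" "f \<le> 2 * r" "2 * s \<le> n"
      using f False by (auto simp: s_def r_def)
    have m2: "m \<ge> 2" using s by (simp add: m_def less_eq_div_iff_mult_less_eq)
    have ms: "m * s \<le> n" by (simp add: m_def)
    have "m * s + n mod s = n" "n mod s < s" using s(1) by (simp_all add: m_def)
    moreover have "2 * s \<le> m * s" using m2 by simp
    ultimately have ms': "n \<le> 2 * (m * s)" by linarith
    obtain VB :: "nat set" and EB where VB: "simple_graph VB EB" "card VB = m"
      "girth EB \<ge> enat (2 * k + 2)" and EB: "real (card EB) \<ge> c * real m powr (1 + 1 / real k)"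
      using gb m2 unfolding girth_bound_def by blast
    obtain E and cv :: "nat \<Rightarrow> nat" and ce :: "nat set \<Rightarrow> nat"
      where E: "simple_graph {..<n} E"
      "s\<^sup>2 * min (r * card EB) (m\<^sup>2) \<le> 8 * card E"
      "\<forall>VH EH. mcft_spanner f (2 * k - 1) {..<n} E cv ce VH EH \<longrightarrow> E \<subseteq> EH"
      using layered_graph_exists[OF VB, of s n r f] m2 ms s by auto
    have "min c 1 / 64 * B \<le> real (card E)"
    proof (cases "r * card EB \<le> m\<^sup>2")
      case True
      define x where "x = 1 / real k"
      have x: "0 < x" "x \<le> 1" using k by (auto simp: x_def)
      have pos: "real s > 0" "real m > 0" "real f > 0" using s(1) m2 f by auto
      have "real f \<le> real (2 * s)" "real f \<le> real (2 * r)" "real n \<le> real (2 * (m * s))"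
        using s ms' by (simp_all only: of_nat_mono)
      then have fs: "real f \<le> 2 * real s" and fr: "real f \<le> 2 * real r"
        and nms: "real n \<le> 2 * (real m * real s)" by simp_all
      have split: "2 * (real m * real s) = (2 * real s) * real m" by simp
      have "real f powr (2 - x) * real n powr (1 + x)
          = real f * (real f powr (1 - x) * real n powr (1 + x))"
        using pos by (simp add: powr_diff powr_add field_simps power2_eq_square)
      also have "\<dots> \<le> (2 * real r) * ((2 * real s) powr (1 - x) * (2 * (real m * real s)) powr (1 + x))"
        using fs fr nms x by (intro mult_mono powr_mono2) auto
      \<comment> \<open>The exponents of \<open>2 * s\<close> add up to 2, so the loss is 8 for
        every \<open>k\<close>; with the 8 from the layered graph this makes 64.\<close>
      also have "\<dots> = 2 * real r * ((2 * real s) powr ((1 - x) + (1 + x)) * real m powr (1 + x))"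
        unfolding powr_add split by (simp add: powr_mult)
      also have "\<dots> = 8 * (real r * (real s)\<^sup>2 * real m powr (1 + x))"
        using pos by (simp add: power_mult_distrib)
      finally have B: "B \<le> 8 * (real r * (real s)\<^sup>2 * real m powr (1 + x))"
        by (simp add: B_def x_def)
      have "min c 1 / 64 * B \<le> c / 64 * (8 * (real r * (real s)\<^sup>2 * real m powr (1 + x)))"
        using c B by (intro mult_mono) (auto simp: B_def)
      also have "\<dots> = (real s)\<^sup>2 * (real r * (c * real m powr (1 + x))) / 8" by simp
      also have "\<dots> \<le> (real s)\<^sup>2 * (real r * real (card EB)) / 8"
        using EB by (intro divide_right_mono mult_left_mono) (auto simp: x_def)
      also have "\<dots> = real (s\<^sup>2 * (r * card EB)) / 8" by simp
      also have "\<dots> \<le> real (8 * card E) / 8"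
        using E(2) True by (intro divide_right_mono of_nat_mono) (simp_all add: min.absorb1)
      also have "\<dots> = real (card E)" by simp
      finally show ?thesis .
    next
      case False
      then have "s\<^sup>2 * m\<^sup>2 \<le> 8 * card E" using E(2) by (simp add: min_def)
      moreover have "n\<^sup>2 \<le> (2 * (m * s))\<^sup>2" using ms' by (rule power_mono) simp
      ultimately have "n\<^sup>2 \<le> 32 * card E" by (simp add: power_mult_distrib mult.commute)
      then have "real (n\<^sup>2) \<le> real (32 * card E)" by (rule of_nat_mono)
      then have "(real n)\<^sup>2 \<le> 32 * real (card E)" by simp
      moreover have "min c 1 / 64 * B \<le> 1 / 64 * (real n)\<^sup>2"
        using c by (intro mult_mono) (auto simp: B_def)
      ultimately show ?thesis by simp
    qed
    then show ?thesis using E by blast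
  qed
  then obtain E and cv :: "nat \<Rightarrow> nat" and ce :: "nat set \<Rightarrow> nat"
    where E: "simple_graph {..<n} E" "min c 1 / 64 * B \<le> real (card E)"
    "\<And>VH EH. mcft_spanner f (2 * k - 1) {..<n} E cv ce VH EH \<Longrightarrow> E \<subseteq> EH"
    by blast
  have "min c 1 / 64 * B \<le> real (card EH)"
    if "mcft_spanner f (2 * k - 1) {..<n} E cv ce VH EH" for VH EH
  proof -
    have "EH = E" using E(3)[OF that] that by (auto simp: mcft_spanner_def)
    then show ?thesis using E(2) by simp
  qed
  then show "\<exists>(V :: nat set) E (cv :: nat \<Rightarrow> nat) (ce :: nat set \<Rightarrow> nat).
        simple_graph V E \<and> card V = n \<and>
        (\<forall>VH EH. mcft_spanner f (2 * k - 1) V E cv ce VH EH \<longrightarrow>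
           real (card EH) \<ge> min c 1 / 64 *
             min (real f powr (2 - 1 / real k) * real n powr (1 + 1 / real k)) ((real n)\<^sup>2))"
    using E(1) card_lessThan unfolding B_def by blast
qed

theorem theorem4p4:
  "(erdos_girth_conjecture \<longrightarrow> (\<forall>k\<ge>1. \<exists>c>0. mcft_lower_bound c k)) \<and>
   (erdos_girth_conjecture_absolute \<longrightarrow> (\<exists>c>0. \<forall>k\<ge>1. mcft_lower_bound c k))"
proof -
  have pos: "min c 1 / 64 > 0" if "c > 0" for c :: real using that by simp
  show ?thesis
    unfolding erdos_girth_conjecture_def erdos_girth_conjecture_absolute_def
    using mcft_lower_bound_of_girth_bound pos by meson
qed

end
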